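(* Every finite permutation $\pi=(A,\leqslant_1,\leqslant_2)$ is quasi-projective.
   Context: A permutation is a structure $\pi=(A,\leqslant_1,\leqslant_2)$ where $\leqslant_1$ and $\leqslant_2$ are two reflexive total orders on the set $A$. A homomorphism between permutations $(A,\leqslant_1,\leqslant_2)\to(B,\leqslant_1',\leqslant_2')$ is a map $h:A\to B$ such that $a\leqslant_1 b$ implies $h(a)\leqslant_1' h(b)$ and $a\leqslant_2 b$ implies $h(a)\leqslant_2' h(b)$; an epimorphism is a surjective homomorphism. A permutation $\pi$ is quasi-projective if for every permutation $\sigma$, every homomorphism $f:\pi\to\sigma$ and every epimorphism $j:\pi\to\sigma$, there is an endomorphism $\phi$ of $\pi$ with $j\circ\phi=f$. *)

theory Defs
  imports Main "HOL-Library.FuncSet"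
begin

record 'a perm_struct =
  points :: "'a set"
  ord1 :: "'a rel"
  ord2 :: "'a rel"

definition permutation :: "'a perm_struct \<Rightarrow> bool" where
  "permutation \<pi> \<longleftrightarrow>
     linear_order_on (points \<pi>) (ord1 \<pi>) \<and> linear_order_on (points \<pi>) (ord2 \<pi>)"

text \<open>Homomorphisms are HOL functions of which only the values on \<open>points \<pi>\<close> matter.\<close>

definition perm_hom :: "'a perm_struct \<Rightarrow> 'b perm_struct \<Rightarrow> ('a \<Rightarrow> 'b) \<Rightarrow> bool" where
  "perm_hom \<pi> \<sigma> h \<longleftrightarrow>
     h \<in> points \<pi> \<rightarrow> points \<sigma> \<and>
     (\<forall>a\<in>points \<pi>. \<forall>b\<in>points \<pi>.
        ((a, b) \<in> ord1 \<pi> \<longrightarrow> (h a, h b) \<in> ord1 \<sigma>) \<and>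
        ((a, b) \<in> ord2 \<pi> \<longrightarrow> (h a, h b) \<in> ord2 \<sigma>))"

definition perm_epi :: "'a perm_struct \<Rightarrow> 'b perm_struct \<Rightarrow> ('a \<Rightarrow> 'b) \<Rightarrow> bool" where
  "perm_epi \<pi> \<sigma> h \<longleftrightarrow> perm_hom \<pi> \<sigma> h \<and> h ` points \<pi> = points \<sigma>"

text \<open>HOL cannot quantify over types inside a formula, so the type from which the points of
  \<open>\<sigma>\<close> are drawn is a parameter; quasi-projectivity proper is the statement for all \<open>'b\<close>,
  i.e. with \<open>'b\<close> a free type variable of the theorem.\<close>

definition quasi_projective :: "'b itself \<Rightarrow> 'a perm_struct \<Rightarrow> bool" where
  "quasi_projective (_ :: 'b itself) \<pi> \<longleftrightarrow>
     (\<forall>\<sigma> :: 'b perm_struct. \<forall>f j.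
        permutation \<sigma> \<longrightarrow> perm_hom \<pi> \<sigma> f \<longrightarrow> perm_epi \<pi> \<sigma> j \<longrightarrow>
        (\<exists>\<phi>. perm_hom \<pi> \<pi> \<phi> \<and> (\<forall>a\<in>points \<pi>. (j \<circ> \<phi>) a = f a)))"

end

theory Submission
  imports Defs
begin

text \<open>Since the orders are total, every set-theoretic section \<open>g\<close> of an epimorphism \<open>j\<close> is itself a
  homomorphism, so \<open>g \<circ> f\<close> lifts \<open>f\<close> through \<open>j\<close>.\<close>

text \<open>If \<open>g\<close> reversed a pair, totality of \<open>r\<close> would give
  \<open>(g y, g x) \<in> r\<close>; applying \<open>j\<close> yields \<open>(y, x) \<in> s\<close>,
  so antisymmetry of \<open>s\<close> forces \<open>x = y\<close>, and reflexivity of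
  \<open>r\<close> is contradicted.\<close>

lemma monotone_section:
  assumes A: "linear_order_on A r" and B: "linear_order_on B s"
    and j: "\<And>a b. a \<in> A \<Longrightarrow> b \<in> A \<Longrightarrow> (a, b) \<in> r \<Longrightarrow> (j a, j b) \<in> s"
    and g: "\<And>x. x \<in> B \<Longrightarrow> g x \<in> A \<and> j (g x) = x"
    and x: "x \<in> B" and y: "y \<in> B" and xy: "(x, y) \<in> s"
  shows "(g x, g y) \<in> r"
proof (rule ccontr)
  assume neg: "(g x, g y) \<notin> r"
  have refl: "(g x, g x) \<in> r"
    using A g[OF x] by (auto simp: order_on_defs refl_on_def)
  \<comment> \<open>Totality compares only distinct points, so equality is excluded first.\<close>
  with neg have "g x \<noteq> g y" by auto
  with neg A g[OF x] g[OF y] have "(g y, g x) \<in> r"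
    by (auto simp: order_on_defs total_on_def)
  with j[of "g y" "g x"] g[OF x] g[OF y] have "(y, x) \<in> s" by auto
  with xy B have "x = y" by (auto simp: order_on_defs dest: antisymD)
  with refl neg show False by simp
qed

text \<open>Monotonicity holds for an arbitrary section, so one and the same \<open>g\<close> serves
  both orders, each handled separately.\<close>

lemma perm_hom_section:
  assumes "permutation \<pi>" "permutation \<sigma>" "perm_hom \<pi> \<sigma> j"
    and g: "\<And>x. x \<in> points \<sigma> \<Longrightarrow> g x \<in> points \<pi> \<and> j (g x) = x"
  shows "perm_hom \<sigma> \<pi> g"
  unfolding perm_hom_def
proof (intro conjI ballI impI)
  show "g \<in> points \<sigma> \<rightarrow> points \<pi>" using g by auto
next
  fix x y assume "x \<in> points \<sigma>" "y \<in> points \<sigma>" "(x, y) \<in> ord1 \<sigma>"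
  with assms show "(g x, g y) \<in> ord1 \<pi>"
    by (intro monotone_section[of "points \<pi>" "ord1 \<pi>" "points \<sigma>" "ord1 \<sigma>" j])
      (auto simp: permutation_def perm_hom_def)
next
  fix x y assume "x \<in> points \<sigma>" "y \<in> points \<sigma>" "(x, y) \<in> ord2 \<sigma>"
  with assms show "(g x, g y) \<in> ord2 \<pi>"
    by (intro monotone_section[of "points \<pi>" "ord2 \<pi>" "points \<sigma>" "ord2 \<sigma>" j])
      (auto simp: permutation_def perm_hom_def)
qed

lemma perm_hom_comp:
  assumes "perm_hom \<pi> \<sigma> f" "perm_hom \<sigma> \<tau> g"
  shows "perm_hom \<pi> \<tau> (g \<circ> f)"
  using assms by (auto simp: perm_hom_def Pi_iff)

theorem theorem3p1:
  fixes \<pi> :: "'a perm_struct"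
  assumes "permutation \<pi>" and "finite (points \<pi>)"
  shows "quasi_projective TYPE('b) \<pi>"
  unfolding quasi_projective_def
proof (intro allI impI)
  fix \<sigma> :: "'b perm_struct" and f j
  assume \<sigma>: "permutation \<sigma>" and f: "perm_hom \<pi> \<sigma> f" and j: "perm_epi \<pi> \<sigma> j"
  \<comment> \<open>An arbitrary choice of preimages; surjectivity of \<open>j\<close> makes it a
    section on \<open>points \<sigma>\<close>.\<close>
  define g where "g = inv_into (points \<pi>) j"
  have g: "g x \<in> points \<pi> \<and> j (g x) = x" if "x \<in> points \<sigma>" for x
    using j that by (auto simp: perm_epi_def g_def inv_into_into f_inv_into_f)
  have "perm_hom \<sigma> \<pi> g"
    using perm_hom_section[OF assms(1) \<sigma> _ g] j by (simp add: perm_epi_def)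
  with f have "perm_hom \<pi> \<pi> (g \<circ> f)" by (rule perm_hom_comp)
  \<comment> \<open>The section identity applies at \<open>f a\<close>, which lies in
    \<open>points \<sigma>\<close>.\<close>
  moreover have "\<forall>a\<in>points \<pi>. (j \<circ> (g \<circ> f)) a = f a"
    using f g by (auto simp: perm_hom_def Pi_iff)
  ultimately show "\<exists>\<phi>. perm_hom \<pi> \<pi> \<phi> \<and> (\<forall>a\<in>points \<pi>. (j \<circ> \<phi>) a = f a)" by blast
qed

end
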